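(* Let $(M,\varphi,\xi,\eta,g)$ be a Kenmotsu pseudo-metric manifold with $g(\xi,\xi)=\varepsilon\in\{1,-1\}$, and let $c$ be a real constant. Then $M$ has constant $\varphi$-sectional curvature $c$ if and only if, for all vector fields $X,Y,Z$ on $M$, \begin{align*} 4R(X,Y)Z=&(c-3\varepsilon)\{g(Y,Z)X-g(X,Z)Y\}\\ &+(c+\varepsilon)\{\varepsilon\eta(X)\eta(Z)Y-\varepsilon\eta(Y)\eta(Z)X+\eta(Y)g(X,Z)\xi-\eta(X)g(Y,Z)\xi\\ &\quad+g(X,\varphi Z)\varphi Y-g(Y,\varphi Z)\varphi X+2g(X,\varphi Y)\varphi Z\}. \end{align*}
   Context: Let $M$ be a smooth manifold of dimension $2n+1$, $n\ge 1$. An almost contact pseudo-metric structure $(\varphi,\xi,\eta,g)$ on $M$ consists of a $(1,1)$-tensor field $\varphi$, a vector field $\xi$, a 1-form $\eta$ and a pseudo-Riemannian metric $g$ such that $\varphi^2=-I+\eta\otimes\xi$, $\eta(\xi)=1$, $\varphi\xi=0$, $\eta\circ\varphi=0$, and $g(\varphi X,\varphi Y)=g(X,Y)-\varepsilon\eta(X)\eta(Y)$ for all vector fields $X,Y$, where $\varepsilon=\pm1$; consequently $\eta(X)=\varepsilon g(X,\xi)$, $g(\varphi X,Y)=-g(X,\varphi Y)$ and $g(\xi,\xi)=\varepsilon$. It is a Kenmotsu pseudo-metric manifold if $(\nabla_X\varphi)Y=-\eta(Y)\varphi X-\varepsilon g(X,\varphi Y)\xi$ for all $X,Y$, where $\nabla$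 is the Levi-Civita connection of $g$. The curvature tensor is $R(X,Y)=[\nabla_X,\nabla_Y]-\nabla_{[X,Y]}$. For $X\in\operatorname{Ker}\eta$ that is space-like or time-like (i.e. $g(X,X)\neq 0$), the $\varphi$-sectional curvature is $K(X,\varphi X)=\dfrac{g(R(\varphi X,X)X,\varphi X)}{g(X,X)^2}$. Constant $\varphi$-sectional curvature $c$ means $K(X,\varphi X)=c$ at every point for all such $X$. *)

theory Defs
  imports "HOL-Analysis.Analysis" "HOL-Library.Function_Algebras"
begin

section \<open>Smooth maps between open subsets of Euclidean spaces\<close>

primrec Ck_on :: "nat \<Rightarrow> 'b::euclidean_space set \<Rightarrow> ('b \<Rightarrow> 'c::euclidean_space) \<Rightarrow> bool" where
  "Ck_on 0 U f \<longleftrightarrow> continuous_on U f"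
| "Ck_on (Suc k) U f \<longleftrightarrow>
     (\<forall>x\<in>U. f differentiable (at x)) \<and> (\<forall>v. Ck_on k U (\<lambda>x. frechet_derivative f (at x) v))"

definition smooth_on :: "'b::euclidean_space set \<Rightarrow> ('b \<Rightarrow> 'c::euclidean_space) \<Rightarrow> bool" where
  "smooth_on U f \<longleftrightarrow> open U \<and> (\<forall>k. Ck_on k U f)"


section \<open>Smooth manifolds\<close>

text \<open>The manifold is the whole type \<open>'a\<close>, assumed Hausdorff and second countable. Charts take
  values in the Euclidean space \<open>'b\<close>, so the dimension of the manifold is \<open>DIM('b)\<close>.\<close>

type_synonym ('a, 'b) chart = "'a set \<times> ('a \<Rightarrow> 'b)"

definition is_chart :: "('a::topological_space, 'b::euclidean_space) chart \<Rightarrow> bool" where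
  "is_chart c \<longleftrightarrow> (case c of (U, \<psi>) \<Rightarrow>
     open U \<and> open (\<psi> ` U) \<and> homeomorphism U (\<psi> ` U) \<psi> (inv_into U \<psi>))"

definition smooth_transition ::
    "('a::topological_space, 'b::euclidean_space) chart \<Rightarrow> ('a, 'b) chart \<Rightarrow> bool" where
  "smooth_transition c d \<longleftrightarrow> (case (c, d) of ((U, \<psi>), (V, \<theta>)) \<Rightarrow>
     smooth_on (\<psi> ` (U \<inter> V)) (\<theta> \<circ> inv_into U \<psi>))"

definition smooth_atlas ::
    "('a::{t2_space,second_countable_topology}, 'b::euclidean_space) chart set \<Rightarrow> bool" where
  "smooth_atlas \<A> \<longleftrightarrow>
     (\<forall>c\<in>\<A>. is_chart c) \<and> (\<Union>c\<in>\<A>. fst c) = UNIV \<and>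
     (\<forall>c\<in>\<A>. \<forall>d\<in>\<A>. smooth_transition c d)"

definition smooth_functions ::
    "('a::{t2_space,second_countable_topology}, 'b::euclidean_space) chart set \<Rightarrow> ('a \<Rightarrow> real) set" where
  "smooth_functions \<A> = {f. \<forall>(U, \<psi>)\<in>\<A>. smooth_on (\<psi> ` U) (f \<circ> inv_into U \<psi>)}"


section \<open>Vector fields and tensor fields\<close>

text \<open>Smooth vector fields are the derivations of the algebra of smooth functions, and the value of
  a vector field \<open>X\<close> at the point \<open>p\<close> is the tangent vector \<open>\<lambda>f. X f p\<close>. By convention a vector
  field sends every function that is not smooth to \<open>0\<close>, so that equality of vector fields is
  equality in HOL.\<close>

type_synonym 'a vfield = "('a \<Rightarrow> real) \<Rightarrow> ('a \<Rightarrow> real)"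

definition vector_fields ::
    "('a::{t2_space,second_countable_topology}, 'b::euclidean_space) chart set \<Rightarrow> 'a vfield set" where
  "vector_fields \<A> = {X.
     (\<forall>f\<in>smooth_functions \<A>. X f \<in> smooth_functions \<A>) \<and>
     (\<forall>f. f \<notin> smooth_functions \<A> \<longrightarrow> X f = 0) \<and>
     (\<forall>f\<in>smooth_functions \<A>. \<forall>h\<in>smooth_functions \<A>. X (f + h) = X f + X h) \<and>
     (\<forall>r. \<forall>f\<in>smooth_functions \<A>. X (\<lambda>p. r * f p) = (\<lambda>p. r * X f p)) \<and>
     (\<forall>f\<in>smooth_functions \<A>. \<forall>h\<in>smooth_functions \<A>. X (f * h) = f * X h + h * X f)}"

definition fun_scale :: "('a \<Rightarrow> real) \<Rightarrow> 'a vfield \<Rightarrow> 'a vfield" (infixr "\<odot>" 75) where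
  "h \<odot> X = (\<lambda>f. h * X f)"

definition const_scale :: "real \<Rightarrow> 'a vfield \<Rightarrow> 'a vfield" (infixr "\<cdot>" 75) where
  "r \<cdot> X = (\<lambda>_. r) \<odot> X"

definition lie_bracket :: "'a vfield \<Rightarrow> 'a vfield \<Rightarrow> 'a vfield" where
  "lie_bracket X Y = (\<lambda>f. X (Y f) - Y (X f))"

text \<open>Smooth tensor fields are the multilinear maps over the ring of smooth functions on the module
  of smooth vector fields. They are constrained only on vector fields.\<close>

definition one_form ::
    "('a::{t2_space,second_countable_topology}, 'b::euclidean_space) chart set
      \<Rightarrow> ('a vfield \<Rightarrow> 'a \<Rightarrow> real) \<Rightarrow> bool" where
  "one_form \<A> \<eta> \<longleftrightarrow>
     (\<forall>X\<in>vector_fields \<A>. \<eta> X \<in> smooth_functions \<A>) \<and>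
     (\<forall>X\<in>vector_fields \<A>. \<forall>Y\<in>vector_fields \<A>. \<eta> (X + Y) = \<eta> X + \<eta> Y) \<and>
     (\<forall>h\<in>smooth_functions \<A>. \<forall>X\<in>vector_fields \<A>. \<eta> (h \<odot> X) = h * \<eta> X)"

definition tensor_field_1_1 ::
    "('a::{t2_space,second_countable_topology}, 'b::euclidean_space) chart set
      \<Rightarrow> ('a vfield \<Rightarrow> 'a vfield) \<Rightarrow> bool" where
  "tensor_field_1_1 \<A> \<phi> \<longleftrightarrow>
     (\<forall>X\<in>vector_fields \<A>. \<phi> X \<in> vector_fields \<A>) \<and>
     (\<forall>X\<in>vector_fields \<A>. \<forall>Y\<in>vector_fields \<A>. \<phi> (X + Y) = \<phi> X + \<phi> Y) \<and>
     (\<forall>h\<in>smooth_functions \<A>. \<forall>X\<in>vector_fields \<A>. \<phi> (h \<odot> X) = h \<odot> \<phi> X)"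

text \<open>In the last conjunct, \<open>\<forall>f. X f p = 0\<close> says that the tangent vector of \<open>X\<close> at \<open>p\<close> is zero;
  every tangent vector at \<open>p\<close> is the value at \<open>p\<close> of a global vector field, so this is
  nondegeneracy of the bilinear form induced on each tangent space.\<close>

definition pseudo_riemannian_metric ::
    "('a::{t2_space,second_countable_topology}, 'b::euclidean_space) chart set
      \<Rightarrow> ('a vfield \<Rightarrow> 'a vfield \<Rightarrow> 'a \<Rightarrow> real) \<Rightarrow> bool" where
  "pseudo_riemannian_metric \<A> g \<longleftrightarrow>
     (\<forall>X\<in>vector_fields \<A>. one_form \<A> (g X)) \<and>
     (\<forall>X\<in>vector_fields \<A>. \<forall>Y\<in>vector_fields \<A>. g X Y = g Y X) \<and>
     (\<forall>p. \<forall>X\<in>vector_fields \<A>. (\<forall>Y\<in>vector_fields \<A>. g X Y p = 0) \<longrightarrow> (\<forall>f. X f p = 0))"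


section \<open>Connections and curvature\<close>

definition affine_connection ::
    "('a::{t2_space,second_countable_topology}, 'b::euclidean_space) chart set
      \<Rightarrow> ('a vfield \<Rightarrow> 'a vfield \<Rightarrow> 'a vfield) \<Rightarrow> bool" where
  "affine_connection \<A> D \<longleftrightarrow>
     (\<forall>X\<in>vector_fields \<A>. \<forall>Y\<in>vector_fields \<A>. D X Y \<in> vector_fields \<A>) \<and>
     (\<forall>X\<in>vector_fields \<A>. \<forall>Y\<in>vector_fields \<A>. \<forall>Z\<in>vector_fields \<A>.
        D (X + Y) Z = D X Z + D Y Z \<and> D X (Y + Z) = D X Y + D X Z) \<and>
     (\<forall>h\<in>smooth_functions \<A>. \<forall>X\<in>vector_fields \<A>. \<forall>Y\<in>vector_fields \<A>.
        D (h \<odot> X) Y = h \<odot> D X Y \<and> D X (h \<odot> Y) = X h \<odot> Y + h \<odot> D X Y)"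

definition levi_civita_connection ::
    "('a::{t2_space,second_countable_topology}, 'b::euclidean_space) chart set
      \<Rightarrow> ('a vfield \<Rightarrow> 'a vfield \<Rightarrow> 'a \<Rightarrow> real)
      \<Rightarrow> ('a vfield \<Rightarrow> 'a vfield \<Rightarrow> 'a vfield) \<Rightarrow> bool" where
  "levi_civita_connection \<A> g D \<longleftrightarrow>
     affine_connection \<A> D \<and>
     (\<forall>X\<in>vector_fields \<A>. \<forall>Y\<in>vector_fields \<A>. D X Y - D Y X = lie_bracket X Y) \<and>
     (\<forall>X\<in>vector_fields \<A>. \<forall>Y\<in>vector_fields \<A>. \<forall>Z\<in>vector_fields \<A>.
        X (g Y Z) = g (D X Y) Z + g Y (D X Z))"

definition curvature ::
    "('a vfield \<Rightarrow> 'a vfield \<Rightarrow> 'a vfield) \<Rightarrow> 'a vfield \<Rightarrow> 'a vfield \<Rightarrow> 'a vfield \<Rightarrow> 'a vfield" where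
  "curvature D X Y Z = D X (D Y Z) - D Y (D X Z) - D (lie_bracket X Y) Z"

definition covariant_derivative_1_1 ::
    "('a vfield \<Rightarrow> 'a vfield \<Rightarrow> 'a vfield) \<Rightarrow> 'a vfield \<Rightarrow> ('a vfield \<Rightarrow> 'a vfield) \<Rightarrow> 'a vfield \<Rightarrow> 'a vfield"
  where "covariant_derivative_1_1 D X \<phi> Y = D X (\<phi> Y) - \<phi> (D X Y)"


section \<open>Kenmotsu pseudo-metric manifolds\<close>

definition almost_contact_pseudo_metric ::
    "('a::{t2_space,second_countable_topology}, 'b::euclidean_space) chart set
      \<Rightarrow> ('a vfield \<Rightarrow> 'a vfield) \<Rightarrow> 'a vfield \<Rightarrow> ('a vfield \<Rightarrow> 'a \<Rightarrow> real)
      \<Rightarrow> ('a vfield \<Rightarrow> 'a vfield \<Rightarrow> 'a \<Rightarrow> real) \<Rightarrow> real \<Rightarrow> bool" where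
  "almost_contact_pseudo_metric \<A> \<phi> \<xi> \<eta> g \<epsilon> \<longleftrightarrow>
     tensor_field_1_1 \<A> \<phi> \<and> \<xi> \<in> vector_fields \<A> \<and> one_form \<A> \<eta> \<and>
     pseudo_riemannian_metric \<A> g \<and> \<epsilon> \<in> {1, -1} \<and>
     (\<forall>X\<in>vector_fields \<A>. \<phi> (\<phi> X) = - X + \<eta> X \<odot> \<xi>) \<and>
     \<eta> \<xi> = (\<lambda>_. 1) \<and> \<phi> \<xi> = 0 \<and>
     (\<forall>X\<in>vector_fields \<A>. \<eta> (\<phi> X) = 0) \<and>
     (\<forall>X\<in>vector_fields \<A>. \<forall>Y\<in>vector_fields \<A>.
        g (\<phi> X) (\<phi> Y) = g X Y - (\<lambda>_. \<epsilon>) * \<eta> X * \<eta> Y)"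

definition kenmotsu_pseudo_metric ::
    "('a::{t2_space,second_countable_topology}, 'b::euclidean_space) chart set
      \<Rightarrow> ('a vfield \<Rightarrow> 'a vfield) \<Rightarrow> 'a vfield \<Rightarrow> ('a vfield \<Rightarrow> 'a \<Rightarrow> real)
      \<Rightarrow> ('a vfield \<Rightarrow> 'a vfield \<Rightarrow> 'a \<Rightarrow> real) \<Rightarrow> real
      \<Rightarrow> ('a vfield \<Rightarrow> 'a vfield \<Rightarrow> 'a vfield) \<Rightarrow> bool" where
  "kenmotsu_pseudo_metric \<A> \<phi> \<xi> \<eta> g \<epsilon> D \<longleftrightarrow>
     almost_contact_pseudo_metric \<A> \<phi> \<xi> \<eta> g \<epsilon> \<and> levi_civita_connection \<A> g D \<and>
     (\<forall>X\<in>vector_fields \<A>. \<forall>Y\<in>vector_fields \<A>.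
        covariant_derivative_1_1 D X \<phi> Y = - (\<eta> Y \<odot> \<phi> X) - \<epsilon> \<cdot> g X (\<phi> Y) \<odot> \<xi>)"

text \<open>Curvature and metric are tensorial, so for \<open>X\<close> a vector field the following number depends
  only on the tangent vector of \<open>X\<close> at \<open>p\<close>. Since every tangent vector at \<open>p\<close> is the value of
  some vector field, quantifying over vector fields that satisfy the conditions at \<open>p\<close> is the same
  as quantifying over the non-null tangent vectors at \<open>p\<close> in the kernel of \<open>\<eta>\<close>.\<close>

definition phi_sectional_curvature ::
    "('a vfield \<Rightarrow> 'a vfield) \<Rightarrow> ('a vfield \<Rightarrow> 'a vfield \<Rightarrow> 'a \<Rightarrow> real)
      \<Rightarrow> ('a vfield \<Rightarrow> 'a vfield \<Rightarrow> 'a vfield) \<Rightarrow> 'a \<Rightarrow> 'a vfield \<Rightarrow> real" where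
  "phi_sectional_curvature \<phi> g D p X = g (curvature D (\<phi> X) X X) (\<phi> X) p / (g X X p)\<^sup>2"

definition constant_phi_sectional_curvature ::
    "('a::{t2_space,second_countable_topology}, 'b::euclidean_space) chart set
      \<Rightarrow> ('a vfield \<Rightarrow> 'a vfield) \<Rightarrow> ('a vfield \<Rightarrow> 'a \<Rightarrow> real)
      \<Rightarrow> ('a vfield \<Rightarrow> 'a vfield \<Rightarrow> 'a \<Rightarrow> real)
      \<Rightarrow> ('a vfield \<Rightarrow> 'a vfield \<Rightarrow> 'a vfield) \<Rightarrow> real \<Rightarrow> bool" where
  "constant_phi_sectional_curvature \<A> \<phi> \<eta> g D c \<longleftrightarrow>
     (\<forall>p. \<forall>X\<in>vector_fields \<A>. \<eta> X p = 0 \<and> g X X p \<noteq> 0 \<longrightarrow>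
        phi_sectional_curvature \<phi> g D p X = c)"

end

theory Submission
  imports Defs
begin

text \<open>The Kenmotsu condition by itself already determines a large part of the curvature. It gives
\<open>D X \<xi> = X - \<eta> X \<odot> \<xi>\<close> (\<open>D_\<xi>\<close>), and differentiating once more gives \<open>R X Y \<xi>\<close>
(\<open>R_\<xi>\<close>) and the commutator of \<open>R X Y\<close> with \<open>\<phi>\<close> (\<open>R_\<phi>\<close>). The right-hand side of the theorem,
called \<open>space_form c X Y Z\<close> below, satisfies the same identities up to the factor 4 for every value
of \<open>c\<close>. Therefore the difference
\<open>T(X, Y, Z, W) = 4 g(R(X, Y)Z, W) - g(space_form c X Y Z, W)\<close>, called \<open>defect\<close>, has at every point
the symmetries of a curvature tensor, vanishes as soon as one argument is \<open>\<xi>\<close>, and satisfies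
\<open>T(X, Y, \<phi>Z, W) = - T(X, Y, Z, \<phi>W)\<close>. In other words it lives on the kernel of \<open>\<eta>\<close>, where \<open>\<phi>\<close> is a
complex structure, and there it has the symmetries of the curvature tensor of a Kaehler manifold.

For \<open>X\<close> in the kernel of \<open>\<eta>\<close> at \<open>p\<close>, the number \<open>T(X, \<phi>X, X, \<phi>X)\<close> is
\<open>4 (c g(X, X)\<^sup>2 - g(R(\<phi>X, X)X, \<phi>X))\<close>. So constant \<open>\<phi>\<close>-sectional curvature \<open>c\<close> says
that \<open>T(X, \<phi>X, X, \<phi>X)\<close> vanishes for the non-null \<open>X\<close> in this kernel. By continuity it then
vanishes for the null ones (\<open>defect_\<phi>_sectional_null\<close>), hence for all \<open>X\<close>, because \<open>\<xi>\<close> contributes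
nothing. Polarisation, as in the classical theorem that the holomorphic sectional curvatures of a
Kaehler manifold determine its curvature, yields \<open>T = 0\<close> (\<open>zero_if_J_sectional_zero\<close>). Since \<open>g\<close>
is nondegenerate, \<open>T = 0\<close> at all points is the asserted formula. The converse is immediate from
the same value of \<open>T(X, \<phi>X, X, \<phi>X)\<close>.

Vector fields are global derivations, so every pointwise statement is made for numbers such as
\<open>g X Y p\<close>. Tangent vectors and local extensions are avoided: that \<open>T\<close> depends only on
the values of its arguments at \<open>p\<close> is needed only for multiples of \<open>\<xi>\<close> and for arguments that are
\<open>g\<close>-orthogonal to everything at \<open>p\<close>, and both cases follow from the symmetries together with
the linearity of \<open>g\<close> over the smooth functions.\<close>

section \<open>The algebra of smooth functions\<close>

text \<open>The derivative at a point of an open set only sees the function on that set. This lets the sum and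
product rules below, which hold only where the factors are differentiable, be used inside \<open>Ck_on\<close>.\<close>

lemma Ck_on_cong:
  assumes "open U" "\<And>x. x \<in> U \<Longrightarrow> f x = h x" "Ck_on k U f"
  shows "Ck_on k U h"
  using assms(2,3)
proof (induction k arbitrary: f h)
  case 0
  then show ?case using continuous_on_cong by force
next
  case (Suc k)
  have "h differentiable (at x)" if "x \<in> U" for x
    using Suc.prems that has_derivative_transform_within_open[OF _ assms(1) that, where g = h and f = f
        and t = UNIV]
    by (simp add: differentiable_def) blast
  moreover have "Ck_on k U (\<lambda>x. frechet_derivative h (at x) v)" for v
  proof (rule Suc.IH)
    show "frechet_derivative f (at x) v = frechet_derivative h (at x) v" if "x \<in> U" for x
      using frechet_derivative_transform_within_open[OF _ assms(1) that, of f h] Suc.prems that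
      by simp
    show "Ck_on k U (\<lambda>x. frechet_derivative f (at x) v)"
      using Suc.prems(2) by simp
  qed
  ultimately show ?case by simp
qed

lemma Ck_on_Suc_imp:
  assumes "Ck_on (Suc k) U f"
  shows "Ck_on k U f"
  using assms
proof (induction k arbitrary: f)
  case 0
  then show ?case
    by (auto intro!: continuous_at_imp_continuous_on differentiable_imp_continuous_within)
next
  case (Suc k)
  then show ?case
    using Ck_on.simps(2)[of "Suc k" U f] Ck_on.simps(2)[of k U f] by blast
qed

lemma Ck_on_const: "Ck_on k U (\<lambda>_. r)"
  by (induction k arbitrary: r) simp_all

lemma Ck_on_add:
  assumes "open U" "Ck_on k U f" "Ck_on k U h"
  shows "Ck_on k U (\<lambda>x. f x + h x)"
  using assms(2,3)
proof (induction k arbitrary: f h)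
  case 0
  then show ?case by (simp add: continuous_on_add)
next
  case (Suc k)
  have "frechet_derivative (\<lambda>y. f y + h y) (at x) v
      = frechet_derivative f (at x) v + frechet_derivative h (at x) v" if "x \<in> U" for x v
  proof -
    have "(f has_derivative frechet_derivative f (at x)) (at x)"
      "(h has_derivative frechet_derivative h (at x)) (at x)"
      using Suc.prems that by (simp_all add: frechet_derivative_works)
    from fun_cong[OF frechet_derivative_at[OF has_derivative_add[OF this]], of v] show ?thesis
      by simp
  qed
  then have "Ck_on k U (\<lambda>x. frechet_derivative (\<lambda>y. f y + h y) (at x) v)" for v
    using Ck_on_cong[OF assms(1) _ Suc.IH[of "\<lambda>x. frechet_derivative f (at x) v"
        "\<lambda>x. frechet_derivative h (at x) v"],
        where h = "\<lambda>x. frechet_derivative (\<lambda>y. f y + h y) (at x) v"] Suc.prems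
    by simp
  then show ?case using Suc.prems by simp
qed

lemma Ck_on_mult:
  fixes f h :: "'b::euclidean_space \<Rightarrow> real"
  assumes "open U" "Ck_on k U f" "Ck_on k U h"
  shows "Ck_on k U (\<lambda>x. f x * h x)"
  using assms(2,3)
proof (induction k arbitrary: f h)
  case 0
  then show ?case by (simp add: continuous_on_mult)
next
  case (Suc k)
  have "frechet_derivative (\<lambda>y. f y * h y) (at x) v
      = f x * frechet_derivative h (at x) v + frechet_derivative f (at x) v * h x"
    if "x \<in> U" for x v
  proof -
    have "(f has_derivative frechet_derivative f (at x)) (at x)"
      "(h has_derivative frechet_derivative h (at x)) (at x)"
      using Suc.prems that by (auto simp: frechet_derivative_works)
    from fun_cong[OF frechet_derivative_at[OF has_derivative_mult[OF this]], of v] show ?thesis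
      by simp
  qed
  moreover have "Ck_on k U (\<lambda>x. f x * frechet_derivative h (at x) v
      + frechet_derivative f (at x) v * h x)" for v
    using Suc.prems Ck_on_Suc_imp[OF Suc.prems(1)] Ck_on_Suc_imp[OF Suc.prems(2)]
    by (intro Ck_on_add assms(1) Suc.IH) auto
  ultimately have "Ck_on k U (\<lambda>x. frechet_derivative (\<lambda>y. f y * h y) (at x) v)" for v
    using Ck_on_cong[OF assms(1), where h = "\<lambda>x. frechet_derivative (\<lambda>y. f y * h y) (at x) v"
        and f = "\<lambda>x. f x * frechet_derivative h (at x) v + frechet_derivative f (at x) v * h x"]
    by simp
  then show ?case using Suc.prems by simp
qed

lemma smooth_functions_iff:
  "f \<in> smooth_functions \<A> \<longleftrightarrow>
    (\<forall>c\<in>\<A>. open (snd c ` fst c) \<and> (\<forall>k. Ck_on k (snd c ` fst c) (\<lambda>x. f (inv_into (fst c) (snd c) x))))"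
  by (simp add: smooth_functions_def smooth_on_def o_def case_prod_beta)

lemma smooth_functions_const:
  assumes "smooth_atlas \<A>"
  shows "(\<lambda>_. r) \<in> smooth_functions \<A>"
  using assms
  by (simp add: smooth_functions_iff smooth_atlas_def is_chart_def case_prod_beta Ck_on_const)

lemma smooth_functions_add:
  assumes "f \<in> smooth_functions \<A>" "h \<in> smooth_functions \<A>"
  shows "f + h \<in> smooth_functions \<A>"
  using assms by (simp add: smooth_functions_iff Ck_on_add)

lemma smooth_functions_mult:
  assumes "f \<in> smooth_functions \<A>" "h \<in> smooth_functions \<A>"
  shows "f * h \<in> smooth_functions \<A>"
  using assms by (simp add: smooth_functions_iff Ck_on_mult)

section \<open>Curvature-like tensors and complex structures\<close>

text \<open>The symmetries of a curvature tensor at one point, on an arbitrary abelian group \<open>V\<close> of arguments.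
For vector fields, \<open>T X Y Z W\<close> is the value at a point of a 4-tensor; the polarisation
arguments below need only sums and negatives. Additivity is postulated for the last argument, and the
symmetries carry it to the others.\<close>

locale algebraic_curvature =
  fixes V :: "'v::ab_group_add set" and T :: "'v \<Rightarrow> 'v \<Rightarrow> 'v \<Rightarrow> 'v \<Rightarrow> real"
  assumes add_closed [simp]: "X \<in> V \<Longrightarrow> Y \<in> V \<Longrightarrow> X + Y \<in> V"
    and uminus_closed [simp]: "X \<in> V \<Longrightarrow> - X \<in> V"
    and add4: "\<lbrakk>X \<in> V; Y \<in> V; Z \<in> V; W \<in> V; W' \<in> V\<rbrakk>
      \<Longrightarrow> T X Y Z (W + W') = T X Y Z W + T X Y Z W'"
    and skew12: "\<lbrakk>X \<in> V; Y \<in> V; Z \<in> V; W \<in> V\<rbrakk> \<Longrightarrow> T Y X Z W = - T X Y Z W"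
    and skew34: "\<lbrakk>X \<in> V; Y \<in> V; Z \<in> V; W \<in> V\<rbrakk> \<Longrightarrow> T X Y W Z = - T X Y Z W"
    and bianchi: "\<lbrakk>X \<in> V; Y \<in> V; Z \<in> V; W \<in> V\<rbrakk>
      \<Longrightarrow> T X Y Z W + T Y Z X W + T Z X Y W = 0"
begin

text \<open>The octahedron argument: add the cyclic identities for the four choices of the fixed argument, with
suitable signs, so that the skew symmetries cancel everything except two copies of each side.\<close>

lemma pair_symmetric:
  assumes V: "X \<in> V" "Y \<in> V" "Z \<in> V" "W \<in> V"
  shows "T Z W X Y = T X Y Z W"
  using bianchi[OF V] bianchi[OF V(2,3,4,1)] bianchi[OF V(3,4,1,2)] bianchi[OF V(4,1,2,3)]
    skew12[OF V] skew12[OF V(2,3,1,4)] skew12[OF V(3,1,2,4)] skew12[OF V(3,4,1,2)]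
    skew12[OF V(4,1,2,3)] skew12[OF V(4,2,1,3)]
    skew34[OF V] skew34[OF V(2,3,1,4)] skew34[OF V(1,3,2,4)] skew34[OF V(3,4,1,2)]
    skew34[OF V(4,1,2,3)] skew34[OF V(4,2,1,3)]
  by linarith

lemma add3:
  assumes "X \<in> V" "Y \<in> V" "Z \<in> V" "Z' \<in> V" "W \<in> V"
  shows "T X Y (Z + Z') W = T X Y Z W + T X Y Z' W"
  using assms add4[of X Y W Z Z'] skew34[of X Y W Z] skew34[of X Y W Z'] skew34[of X Y W "Z + Z'"]
  by simp

lemma add1:
  assumes "X \<in> V" "X' \<in> V" "Y \<in> V" "Z \<in> V" "W \<in> V"
  shows "T (X + X') Y Z W = T X Y Z W + T X' Y Z W"
  using assms add3[of Z W X X' Y] by (simp add: pair_symmetric[of Z W])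

lemma add2:
  assumes "X \<in> V" "Y \<in> V" "Y' \<in> V" "Z \<in> V" "W \<in> V"
  shows "T X (Y + Y') Z W = T X Y Z W + T X Y' Z W"
  using assms add4[of Z W X Y Y'] by (simp add: pair_symmetric[of Z W])

lemmas additive = add1 add2 add3 add4

lemma zero_closed: "X \<in> V \<Longrightarrow> 0 \<in> V"
  using add_closed[of X "- X"] by simp

lemma minus4:
  assumes V: "X \<in> V" "Y \<in> V" "Z \<in> V" "W \<in> V"
  shows "T X Y Z (- W) = - T X Y Z W"
  using V zero_closed[OF V(1)] add4[of X Y Z W "- W"] add4[of X Y Z 0 0] by simp

lemma minus3:
  assumes V: "X \<in> V" "Y \<in> V" "Z \<in> V" "W \<in> V"
  shows "T X Y (- Z) W = - T X Y Z W"
  using minus4[OF V(1,2,4,3)] skew34[OF V] skew34[OF V(1,2) uminus_closed[OF V(3)] V(4)] by linarith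

lemma minus2:
  assumes V: "X \<in> V" "Y \<in> V" "Z \<in> V" "W \<in> V"
  shows "T X (- Y) Z W = - T X Y Z W"
  using minus4[OF V(3,4,1,2)] pair_symmetric[OF V]
    pair_symmetric[OF V(1) uminus_closed[OF V(2)] V(3,4)] by linarith

lemma minus1:
  assumes V: "X \<in> V" "Y \<in> V" "Z \<in> V" "W \<in> V"
  shows "T (- X) Y Z W = - T X Y Z W"
  using minus3[OF V(3,4,1,2)] pair_symmetric[OF V]
    pair_symmetric[OF uminus_closed[OF V(1)] V(2,3,4)] by linarith

lemmas minus = minus1 minus2 minus3 minus4

text \<open>Polarising \<open>Y\<close>, then \<open>X\<close>, makes \<open>T\<close> skew in its first and third argument as well. The
cyclic sum then consists of three equal terms.\<close>

lemma zero_if_sectional_zero: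
  assumes sec: "\<And>X Y. X \<in> V \<Longrightarrow> Y \<in> V \<Longrightarrow> T X Y X Y = 0"
    and V: "X \<in> V" "Y \<in> V" "Z \<in> V" "W \<in> V"
  shows "T X Y Z W = 0"
proof -
  have a: "T X Y X W = 0" if "X \<in> V" "Y \<in> V" "W \<in> V" for X Y W
    using sec[of X "Y + W"] sec[of X Y] sec[of X W] that pair_symmetric[of X Y X W]
    by (simp add: additive)
  have b: "T X Y Z W = - T Z Y X W" if "X \<in> V" "Y \<in> V" "Z \<in> V" "W \<in> V" for X Y Z W
    using a[of "X + Z" Y W] a[of X Y W] a[of Z Y W] that by (simp add: additive)
  show ?thesis
    using bianchi[OF V] b[OF V] b[OF V(2,1,3,4)] skew12[OF V] skew12[OF V(2,3,1,4)]
      skew12[OF V(3,1,2,4)]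
    by linarith
qed

end

text \<open>The symmetries of a Kaehler curvature tensor. The relation \<open>J\<^sup>2 = - 1\<close> is asked for only inside
\<open>T\<close>, because \<open>\<phi>\<^sup>2 = - 1\<close> fails in the direction of \<open>\<xi>\<close>, which the tensor does not see.\<close>

locale kaehler_type_curvature = algebraic_curvature V T
  for V :: "'v::ab_group_add set" and T +
  fixes J :: "'v \<Rightarrow> 'v"
  assumes J_closed [simp]: "X \<in> V \<Longrightarrow> J X \<in> V"
    and J_add: "X \<in> V \<Longrightarrow> Y \<in> V \<Longrightarrow> J (X + Y) = J X + J Y"
    and J_skew: "\<lbrakk>X \<in> V; Y \<in> V; Z \<in> V; W \<in> V\<rbrakk> \<Longrightarrow> T X Y (J Z) W = - T X Y Z (J W)"
    and J_square: "\<lbrakk>X \<in> V; Y \<in> V; Z \<in> V; W \<in> V\<rbrakk> \<Longrightarrow> T X Y Z (J (J W)) = - T X Y Z W"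
begin

lemma J_invariant:
  assumes "X \<in> V" "Y \<in> V" "Z \<in> V" "W \<in> V"
  shows "T X Y (J Z) (J W) = T X Y Z W" "T (J X) (J Y) Z W = T X Y Z W"
proof -
  have *: "T X Y (J Z) (J W) = T X Y Z W" if "X \<in> V" "Y \<in> V" "Z \<in> V" "W \<in> V" for X Y Z W
    using that J_skew[of X Y Z "J W"] J_square by simp
  show "T X Y (J Z) (J W) = T X Y Z W"
    using assms by (rule *)
  show "T (J X) (J Y) Z W = T X Y Z W"
    using assms *[of Z W X Y] pair_symmetric[of Z W] by simp
qed

lemma J_minus: "X \<in> V \<Longrightarrow> J (- X) = - J X"
  using J_add[of X "- X"] J_add[of 0 0] zero_closed[of X]
  by (simp add: eq_neg_iff_add_eq_0 add.commute)

text \<open>Write \<open>a = T(X, JY, X, JY)\<close> and \<open>b = T(X, Y, X, Y)\<close>. The part of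
\<open>T(X, JX, X, JX)\<close> that is quadratic in each of two arguments, together with the cyclic identity,
gives \<open>3 a + b = 0\<close>. Replacing \<open>Y\<close> by \<open>JY\<close> exchanges \<open>a\<close> and \<open>b\<close>, so both vanish.\<close>

lemma zero_if_J_sectional_zero:
  assumes J_sec: "\<And>X. X \<in> V \<Longrightarrow> T X (J X) X (J X) = 0"
    and V: "X \<in> V" "Y \<in> V" "Z \<in> V" "W \<in> V"
  shows "T X Y Z W = 0"
proof (rule zero_if_sectional_zero[OF _ V])
  have key: "3 * T X (J Y) X (J Y) + T X Y X Y = 0" if XY: "X \<in> V" "Y \<in> V" for X Y
  proof -
    \<comment> \<open>Adding the values at \<open>X + Y\<close> and \<open>X - Y\<close> removes the terms of odd degree in \<open>Y\<close>.\<close>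
    have "T (X + Y) (J (X + Y)) (X + Y) (J (X + Y))
        + T (X + - Y) (J (X + - Y)) (X + - Y) (J (X + - Y)) = 0"
      using XY by (simp add: J_sec del: add_uminus_conv_diff)
    then have "T X (J X) Y (J Y) + T Y (J Y) X (J X) + T X (J Y) X (J Y) + T Y (J X) Y (J X)
        + T X (J Y) Y (J X) + T Y (J X) X (J Y) = 0"
      using XY J_sec[of X] J_sec[of Y] by (simp add: J_add J_minus additive minus del: add_uminus_conv_diff)
    moreover have "T Y (J Y) X (J X) = T X (J X) Y (J Y)"
      using XY by (simp add: pair_symmetric)
    moreover have swap: "T Y (J X) Z W = T X (J Y) Z W" if "Z \<in> V" "W \<in> V" for Z W
      using that XY J_invariant(2)[of Y "J X" Z W] J_square[of Z W "J Y" X]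
        pair_symmetric[of Z W "J Y" "J (J X)"] pair_symmetric[of Z W "J Y" X] skew12[of X "J Y" Z W] by simp
    moreover have "T X (J Y) Y (J X) = T X (J Y) X (J Y)"
      using XY swap[of X "J Y"] pair_symmetric[of X "J Y" Y "J X"] by simp
    moreover have "T X (J X) Y (J Y) = T X (J Y) X (J Y) + T X Y X Y"
      using XY bianchi[of X "J X" Y "J Y"] swap[of X "J Y"] skew12[of "J X" Y X "J Y"]
        skew12[of X Y "J X" "J Y"] J_invariant(1)[of X Y X Y] by simp
    ultimately show ?thesis using XY by simp
  qed
  fix X Y assume XY: "X \<in> V" "Y \<in> V"
  have "T X (J (J Y)) X (J (J Y)) = T X Y X Y"
    using XY J_square[of X "J (J Y)" X Y] J_square[of X Y X Y] pair_symmetric[of X Y X "J (J Y)"]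
    by simp
  then show "T X Y X Y = 0"
    using key[OF XY] key[of X "J Y"] XY by simp
qed

end

section \<open>The Levi-Civita connection and its curvature\<close>

locale pseudo_riemannian_manifold =
  fixes \<A> :: "('a::{t2_space,second_countable_topology}, 'b::euclidean_space) chart set"
    and g :: "'a vfield \<Rightarrow> 'a vfield \<Rightarrow> 'a \<Rightarrow> real"
    and D :: "'a vfield \<Rightarrow> 'a vfield \<Rightarrow> 'a vfield"
  assumes atlas: "smooth_atlas \<A>"
    and metric: "pseudo_riemannian_metric \<A> g"
    and levi_civita: "levi_civita_connection \<A> g D"
begin

abbreviation "S \<equiv> smooth_functions \<A>"
abbreviation "V \<equiv> vector_fields \<A>"

lemmas const_smooth [simp] = smooth_functions_const[OF atlas]

lemma plus_smooth [simp]: "f \<in> S \<Longrightarrow> h \<in> S \<Longrightarrow> f + h \<in> S"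
  by (rule smooth_functions_add)

lemma mult_smooth [simp]: "f \<in> S \<Longrightarrow> h \<in> S \<Longrightarrow> f * h \<in> S"
  by (rule smooth_functions_mult)

lemma uminus_smooth [simp]: "f \<in> S \<Longrightarrow> - f \<in> S"
  using mult_smooth[of "\<lambda>_. -1" f] by (simp add: times_fun_def fun_Compl_def)

lemma vf_smooth [simp]: "X \<in> V \<Longrightarrow> f \<in> S \<Longrightarrow> X f \<in> S"
  and vf_outside: "X \<in> V \<Longrightarrow> f \<notin> S \<Longrightarrow> X f = 0"
  and vf_add: "X \<in> V \<Longrightarrow> f \<in> S \<Longrightarrow> h \<in> S \<Longrightarrow> X (f + h) = X f + X h"
  and vf_cmult: "X \<in> V \<Longrightarrow> f \<in> S \<Longrightarrow> X (\<lambda>p. r * f p) = (\<lambda>p. r * X f p)"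
  and vf_mult: "X \<in> V \<Longrightarrow> f \<in> S \<Longrightarrow> h \<in> S \<Longrightarrow> X (f * h) = f * X h + h * X f"
  unfolding vector_fields_def by blast+

lemma vf_const_mult: "X \<in> V \<Longrightarrow> f \<in> S \<Longrightarrow> X ((\<lambda>_. r) * f) = (\<lambda>_. r) * X f"
  using vf_cmult[of X f r] by (simp add: times_fun_def)

text \<open>The product rule for \<open>1 * 1\<close> shows that a derivation kills the function 1.\<close>

lemma vf_const: "X \<in> V \<Longrightarrow> X (\<lambda>_. r) = 0"
  using vf_cmult[of X "\<lambda>_. 1" r] vf_mult[of X "\<lambda>_. 1" "\<lambda>_. 1"]
  by (simp add: times_fun_def plus_fun_def zero_fun_def fun_eq_iff)

lemma vf_uminus: "X \<in> V \<Longrightarrow> f \<in> S \<Longrightarrow> X (- f) = - X f"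
  using vf_cmult[of X f "-1"] by (simp add: fun_Compl_def)

lemma vf_diff: "X \<in> V \<Longrightarrow> f \<in> S \<Longrightarrow> h \<in> S \<Longrightarrow> X (f - h) = X f - X h"
  using vf_add[of X f "- h"] by (simp add: vf_uminus fun_eq_iff)

lemma vfI:
  assumes "\<And>f. f \<in> S \<Longrightarrow> X f \<in> S" "\<And>f. f \<notin> S \<Longrightarrow> X f = 0"
    and "\<And>f h. f \<in> S \<Longrightarrow> h \<in> S \<Longrightarrow> X (f + h) = X f + X h"
    and "\<And>f r. f \<in> S \<Longrightarrow> X (\<lambda>p. r * f p) = (\<lambda>p. r * X f p)"
    and "\<And>f h. f \<in> S \<Longrightarrow> h \<in> S \<Longrightarrow> X (f * h) = f * X h + h * X f"
  shows "X \<in> V"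
  unfolding vector_fields_def using assms by blast

lemma zero_vf [simp]: "0 \<in> V"
  using const_smooth[of 0] by (intro vfI) (simp_all add: zero_fun_def fun_eq_iff)

lemma add_vf [simp]:
  assumes "X \<in> V" "Y \<in> V"
  shows "X + Y \<in> V"
  using assms
  by (intro vfI) (simp_all add: vf_outside vf_add vf_cmult vf_mult fun_eq_iff algebra_simps)

lemma scale_vf [simp]:
  assumes "h \<in> S" "X \<in> V"
  shows "h \<odot> X \<in> V"
  unfolding fun_scale_def using assms
  by (intro vfI) (simp_all add: vf_outside vf_add vf_cmult vf_mult fun_eq_iff algebra_simps)

lemma const_scale_vf [simp]: "X \<in> V \<Longrightarrow> r \<cdot> X \<in> V"
  by (simp add: const_scale_def)

lemma uminus_eq_scale: "- X = (\<lambda>_. -1) \<odot> X"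
  by (simp add: fun_scale_def fun_eq_iff)

lemma uminus_vf [simp]: "X \<in> V \<Longrightarrow> - X \<in> V"
  unfolding uminus_eq_scale by simp

lemma diff_vf [simp]: "X \<in> V \<Longrightarrow> Y \<in> V \<Longrightarrow> X - Y \<in> V"
  using add_vf[of X "- Y"] by simp

lemma g_smooth [simp]: "X \<in> V \<Longrightarrow> Y \<in> V \<Longrightarrow> g X Y \<in> S"
  and g_sym: "X \<in> V \<Longrightarrow> Y \<in> V \<Longrightarrow> g X Y = g Y X"
  and g_add2: "X \<in> V \<Longrightarrow> Y \<in> V \<Longrightarrow> Z \<in> V \<Longrightarrow> g X (Y + Z) = g X Y + g X Z"
  and g_scale2: "h \<in> S \<Longrightarrow> X \<in> V \<Longrightarrow> Y \<in> V \<Longrightarrow> g X (h \<odot> Y) = h * g X Y"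
  using metric unfolding pseudo_riemannian_metric_def one_form_def by blast+

lemma g_nondegenerate:
  assumes "X \<in> V" "\<And>Y. Y \<in> V \<Longrightarrow> g X Y p = 0"
  shows "X f p = 0"
  using metric assms unfolding pseudo_riemannian_metric_def by blast

lemma g_add1: "X \<in> V \<Longrightarrow> Y \<in> V \<Longrightarrow> Z \<in> V \<Longrightarrow> g (X + Y) Z = g X Z + g Y Z"
  using g_add2[of Z X Y] by (simp add: g_sym[of Z])

lemma g_scale1: "h \<in> S \<Longrightarrow> X \<in> V \<Longrightarrow> Y \<in> V \<Longrightarrow> g (h \<odot> X) Y = h * g X Y"
  using g_scale2[of h Y X] by (simp add: g_sym[of Y])

lemma g_uminus: "X \<in> V \<Longrightarrow> Y \<in> V \<Longrightarrow> g (- X) Y = - g X Y"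
    "X \<in> V \<Longrightarrow> Y \<in> V \<Longrightarrow> g X (- Y) = - g X Y"
  unfolding uminus_eq_scale by (simp_all add: g_scale1 g_scale2 fun_eq_iff)

lemma g_diff: "X \<in> V \<Longrightarrow> Y \<in> V \<Longrightarrow> Z \<in> V \<Longrightarrow> g (X - Y) Z = g X Z - g Y Z"
    "X \<in> V \<Longrightarrow> Y \<in> V \<Longrightarrow> Z \<in> V \<Longrightarrow> g X (Y - Z) = g X Y - g X Z"
  using g_add1[of X "- Y" Z] g_add2[of X Y "- Z"] by (simp_all add: g_uminus)

lemma g_const_scale: "X \<in> V \<Longrightarrow> Y \<in> V \<Longrightarrow> g (r \<cdot> X) Y = (\<lambda>_. r) * g X Y"
    "X \<in> V \<Longrightarrow> Y \<in> V \<Longrightarrow> g X (r \<cdot> Y) = (\<lambda>_. r) * g X Y"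
  by (simp_all add: const_scale_def g_scale1 g_scale2)

lemma g_zero: "X \<in> V \<Longrightarrow> g 0 X = 0" "X \<in> V \<Longrightarrow> g X 0 = 0"
  using g_add1[of 0 0 X] g_add2[of X 0 0] by simp_all

lemmas g_linear = g_add1 g_add2 g_scale1 g_scale2 g_uminus g_diff g_const_scale g_zero

lemma D_vf [simp]: "X \<in> V \<Longrightarrow> Y \<in> V \<Longrightarrow> D X Y \<in> V"
  and D_add1: "X \<in> V \<Longrightarrow> Y \<in> V \<Longrightarrow> Z \<in> V \<Longrightarrow> D (X + Y) Z = D X Z + D Y Z"
  and D_add2: "X \<in> V \<Longrightarrow> Y \<in> V \<Longrightarrow> Z \<in> V \<Longrightarrow> D X (Y + Z) = D X Y + D X Z"
  and D_scale1: "h \<in> S \<Longrightarrow> X \<in> V \<Longrightarrow> Y \<in> V \<Longrightarrow> D (h \<odot> X) Y = h \<odot> D X Y"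
  and D_scale2: "h \<in> S \<Longrightarrow> X \<in> V \<Longrightarrow> Y \<in> V \<Longrightarrow> D X (h \<odot> Y) = X h \<odot> Y + h \<odot> D X Y"
  using levi_civita unfolding levi_civita_connection_def affine_connection_def by blast+

lemma covariant_commutator: "X \<in> V \<Longrightarrow> Y \<in> V \<Longrightarrow> D X Y - D Y X = lie_bracket X Y"
  and D_metric: "X \<in> V \<Longrightarrow> Y \<in> V \<Longrightarrow> Z \<in> V \<Longrightarrow> X (g Y Z) = g (D X Y) Z + g Y (D X Z)"
  using levi_civita unfolding levi_civita_connection_def by blast+

lemmas torsion_free = covariant_commutator[symmetric]

lemma D_const_scale: "X \<in> V \<Longrightarrow> Y \<in> V \<Longrightarrow> D (r \<cdot> X) Y = r \<cdot> D X Y"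
    "X \<in> V \<Longrightarrow> Y \<in> V \<Longrightarrow> D X (r \<cdot> Y) = r \<cdot> D X Y"
  by (simp_all add: const_scale_def D_scale1 D_scale2 vf_const)
    (simp add: fun_scale_def fun_eq_iff)

lemma uminus_eq_const_scale: "- X = (- 1) \<cdot> X"
  by (simp add: const_scale_def uminus_eq_scale)

lemma D_uminus: "X \<in> V \<Longrightarrow> Y \<in> V \<Longrightarrow> D (- X) Y = - D X Y"
    "X \<in> V \<Longrightarrow> Y \<in> V \<Longrightarrow> D X (- Y) = - D X Y"
  unfolding uminus_eq_const_scale by (simp_all add: D_const_scale)

lemma D_diff: "X \<in> V \<Longrightarrow> Y \<in> V \<Longrightarrow> Z \<in> V \<Longrightarrow> D (X - Y) Z = D X Z - D Y Z"
    "X \<in> V \<Longrightarrow> Y \<in> V \<Longrightarrow> Z \<in> V \<Longrightarrow> D X (Y - Z) = D X Y - D X Z"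
  using D_add1[of X "- Y" Z] D_add2[of X Y "- Z"] by (simp_all add: D_uminus)

lemma D_zero: "X \<in> V \<Longrightarrow> D X 0 = 0"
  using D_add2[of X 0 0] by simp

lemmas D_linear = D_add1 D_add2 D_scale1 D_scale2 D_const_scale D_uminus D_diff D_zero

abbreviation "R \<equiv> curvature D"

lemma R_eq: "X \<in> V \<Longrightarrow> Y \<in> V \<Longrightarrow> Z \<in> V \<Longrightarrow>
    R X Y Z = D X (D Y Z) - D Y (D X Z) - D (D X Y) Z + D (D Y X) Z"
  by (simp add: curvature_def torsion_free D_linear)

lemma R_vf [simp]: "X \<in> V \<Longrightarrow> Y \<in> V \<Longrightarrow> Z \<in> V \<Longrightarrow> R X Y Z \<in> V"
  by (simp add: R_eq)

lemma R_skew: "X \<in> V \<Longrightarrow> Y \<in> V \<Longrightarrow> Z \<in> V \<Longrightarrow> R Y X Z = - R X Y Z"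
  by (simp add: R_eq)

lemma lie_bracket_vf [simp]: "X \<in> V \<Longrightarrow> Y \<in> V \<Longrightarrow> lie_bracket X Y \<in> V"
  by (simp add: torsion_free)

text \<open>On a smooth function the twelve threefold derivatives cancel; all other functions are sent to 0 by
every vector field.\<close>

lemma jacobi:
  assumes "X \<in> V" "Y \<in> V" "Z \<in> V"
  shows "lie_bracket X (lie_bracket Y Z) + lie_bracket Y (lie_bracket Z X)
    + lie_bracket Z (lie_bracket X Y) = 0"
proof
  fix f
  show "(lie_bracket X (lie_bracket Y Z) + lie_bracket Y (lie_bracket Z X)
    + lie_bracket Z (lie_bracket X Y)) f = 0 f"
  proof (cases "f \<in> S")
    case True
    then show ?thesis using assms by (simp add: lie_bracket_def vf_diff fun_eq_iff)
  next
    case False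
    then show ?thesis
      using assms vf_outside[of "lie_bracket X (lie_bracket Y Z) + lie_bracket Y (lie_bracket Z X)
        + lie_bracket Z (lie_bracket X Y)" f]
      by simp
  qed
qed

text \<open>Expressing the brackets through the torsion-free connection turns the Jacobi identity into this one.\<close>

lemma first_bianchi:
  assumes "X \<in> V" "Y \<in> V" "Z \<in> V"
  shows "R X Y Z + R Y Z X + R Z X Y = 0"
  using jacobi[OF assms] assms
  by (simp add: torsion_free R_eq D_linear algebra_simps)

text \<open>Differentiate \<open>g Z W\<close> twice: the mixed terms are symmetric in \<open>X\<close> and \<open>Y\<close>, so the commutator of
the two derivatives leaves only curvature terms, and it is also the derivative along the bracket.\<close>

lemma R_metric_skew:
  assumes "X \<in> V" "Y \<in> V" "Z \<in> V" "W \<in> V"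
  shows "g (R X Y W) Z = - g (R X Y Z) W"
proof -
  have second: "X (Y (g Z W)) = g (D X (D Y Z)) W + g (D Y Z) (D X W)
      + (g (D X Z) (D Y W) + g Z (D X (D Y W)))"
    if "X \<in> V" "Y \<in> V" for X Y
    using that assms by (simp only: D_metric D_vf vf_add g_smooth)
  have "g (D (lie_bracket X Y) Z) W + g Z (D (lie_bracket X Y) W) = lie_bracket X Y (g Z W)"
    using assms by (simp only: D_metric lie_bracket_vf)
  also have "\<dots> = X (Y (g Z W)) - Y (X (g Z W))"
    by (simp add: lie_bracket_def)
  finally show ?thesis
    using assms second[of X Y] second[of Y X]
    by (simp add: curvature_def g_linear g_sym[of _ Z] fun_eq_iff algebra_simps)
qed

lemma g_R_curvature: "algebraic_curvature V (\<lambda>X Y Z W. g (R X Y Z) W p)"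
proof
  show "g (R X Y Z) W p + g (R Y Z X) W p + g (R Z X Y) W p = 0"
    if "X \<in> V" "Y \<in> V" "Z \<in> V" "W \<in> V" for X Y Z W
  proof -
    have "g (R X Y Z + R Y Z X + R Z X Y) W p = 0"
      using that by (simp add: first_bianchi g_zero)
    then show ?thesis using that by (simp add: g_linear)
  qed
  show "g (R Y X Z) W p = - g (R X Y Z) W p"
    if "X \<in> V" "Y \<in> V" "Z \<in> V" "W \<in> V" for X Y Z W
    using that by (simp add: R_skew[of X Y Z] g_linear)
  show "g (R X Y W) Z p = - g (R X Y Z) W p"
    if "X \<in> V" "Y \<in> V" "Z \<in> V" "W \<in> V" for X Y Z W
    using R_metric_skew[OF that] by simp
qed (simp_all add: g_linear)

end

section \<open>Curvature identities of Kenmotsu manifolds\<close>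

locale kenmotsu_manifold =
  fixes \<A> :: "('a::{t2_space,second_countable_topology}, 'b::euclidean_space) chart set"
    and \<phi> :: "'a vfield \<Rightarrow> 'a vfield" and \<xi> :: "'a vfield"
    and \<eta> :: "'a vfield \<Rightarrow> 'a \<Rightarrow> real"
    and g :: "'a vfield \<Rightarrow> 'a vfield \<Rightarrow> 'a \<Rightarrow> real"
    and D :: "'a vfield \<Rightarrow> 'a vfield \<Rightarrow> 'a vfield"
    and \<epsilon> :: real
  assumes kenmotsu_atlas: "smooth_atlas \<A>"
    and kenmotsu: "kenmotsu_pseudo_metric \<A> \<phi> \<xi> \<eta> g \<epsilon> D"

sublocale kenmotsu_manifold \<subseteq> pseudo_riemannian_manifold \<A> g D
  using kenmotsu_atlas kenmotsu
  by unfold_locales (simp_all add: kenmotsu_pseudo_metric_def almost_contact_pseudo_metric_def)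

context kenmotsu_manifold
begin

lemma \<phi>_vf [simp]: "X \<in> V \<Longrightarrow> \<phi> X \<in> V"
  and \<phi>_add: "X \<in> V \<Longrightarrow> Y \<in> V \<Longrightarrow> \<phi> (X + Y) = \<phi> X + \<phi> Y"
  and \<phi>_scale: "h \<in> S \<Longrightarrow> X \<in> V \<Longrightarrow> \<phi> (h \<odot> X) = h \<odot> \<phi> X"
  and \<xi>_vf [simp]: "\<xi> \<in> V"
  and \<eta>_smooth [simp]: "X \<in> V \<Longrightarrow> \<eta> X \<in> S"
  and \<eta>_add: "X \<in> V \<Longrightarrow> Y \<in> V \<Longrightarrow> \<eta> (X + Y) = \<eta> X + \<eta> Y"
  and \<eta>_scale: "h \<in> S \<Longrightarrow> X \<in> V \<Longrightarrow> \<eta> (h \<odot> X) = h * \<eta> X"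
  and \<epsilon>_cases: "\<epsilon> = 1 \<or> \<epsilon> = - 1"
  and \<phi>_\<phi>: "X \<in> V \<Longrightarrow> \<phi> (\<phi> X) = - X + \<eta> X \<odot> \<xi>"
  and \<eta>_\<xi>: "\<eta> \<xi> = (\<lambda>_. 1)"
  and \<phi>_\<xi>: "\<phi> \<xi> = 0"
  and \<eta>_\<phi>: "X \<in> V \<Longrightarrow> \<eta> (\<phi> X) = 0"
  and g_\<phi>_\<phi>: "X \<in> V \<Longrightarrow> Y \<in> V \<Longrightarrow> g (\<phi> X) (\<phi> Y) = g X Y - (\<lambda>_. \<epsilon>) * \<eta> X * \<eta> Y"
  using kenmotsu
  unfolding kenmotsu_pseudo_metric_def almost_contact_pseudo_metric_def tensor_field_1_1_def
    one_form_def
  by blast+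

lemma \<epsilon>_square: "\<epsilon> * \<epsilon> = 1"
  using \<epsilon>_cases by auto

lemma \<epsilon>_square' [simp]: "\<epsilon> * (\<epsilon> * x) = x"
  using \<epsilon>_cases by auto

lemma \<phi>_const_scale: "X \<in> V \<Longrightarrow> \<phi> (r \<cdot> X) = r \<cdot> \<phi> X"
  by (simp add: const_scale_def \<phi>_scale)

lemma \<phi>_uminus: "X \<in> V \<Longrightarrow> \<phi> (- X) = - \<phi> X"
  unfolding uminus_eq_const_scale by (rule \<phi>_const_scale)

lemma \<phi>_diff: "X \<in> V \<Longrightarrow> Y \<in> V \<Longrightarrow> \<phi> (X - Y) = \<phi> X - \<phi> Y"
  using \<phi>_add[of X "- Y"] by (simp add: \<phi>_uminus)

lemma \<eta>_uminus: "X \<in> V \<Longrightarrow> \<eta> (- X) = - \<eta> X"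
  unfolding uminus_eq_scale by (simp add: \<eta>_scale fun_eq_iff)

lemma \<eta>_diff: "X \<in> V \<Longrightarrow> Y \<in> V \<Longrightarrow> \<eta> (X - Y) = \<eta> X - \<eta> Y"
  using \<eta>_add[of X "- Y"] by (simp add: \<eta>_uminus)

lemma \<eta>_const_scale: "X \<in> V \<Longrightarrow> \<eta> (r \<cdot> X) = (\<lambda>_. r) * \<eta> X"
  by (simp add: const_scale_def \<eta>_scale)

lemmas \<phi>_linear = \<phi>_add \<phi>_scale \<phi>_const_scale \<phi>_uminus \<phi>_diff
lemmas \<eta>_linear = \<eta>_add \<eta>_scale \<eta>_const_scale \<eta>_uminus \<eta>_diff

lemma g_\<xi>: "X \<in> V \<Longrightarrow> g X \<xi> = (\<lambda>_. \<epsilon>) * \<eta> X" "X \<in> V \<Longrightarrow> g \<xi> X = (\<lambda>_. \<epsilon>) * \<eta> X"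
  using g_\<phi>_\<phi>[of X \<xi>] by (simp_all add: \<phi>_\<xi> g_zero \<eta>_\<xi> fun_eq_iff g_sym[of \<xi> X])

lemma g_\<phi>_left: "X \<in> V \<Longrightarrow> Y \<in> V \<Longrightarrow> g (\<phi> X) Y = - g X (\<phi> Y)"
  using g_\<phi>_\<phi>[of X "\<phi> Y"]
  by (simp add: \<eta>_\<phi> \<phi>_\<phi> g_linear g_\<xi> fun_eq_iff) (metis add.inverse_inverse)

lemma g_\<phi>_right: "X \<in> V \<Longrightarrow> Y \<in> V \<Longrightarrow> g Y (\<phi> X) = - g X (\<phi> Y)"
  using g_\<phi>_left[of X Y] g_sym[of Y "\<phi> X"] by simp

lemma D_\<phi>: "X \<in> V \<Longrightarrow> Y \<in> V \<Longrightarrow>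
    D X (\<phi> Y) = \<phi> (D X Y) - \<eta> Y \<odot> \<phi> X - \<epsilon> \<cdot> g X (\<phi> Y) \<odot> \<xi>"
proof -
  assume "X \<in> V" "Y \<in> V"
  then have "D X (\<phi> Y) - \<phi> (D X Y) = - (\<eta> Y \<odot> \<phi> X) - \<epsilon> \<cdot> g X (\<phi> Y) \<odot> \<xi>"
    using kenmotsu by (simp add: kenmotsu_pseudo_metric_def covariant_derivative_1_1_def)
  then show ?thesis by (simp add: algebra_simps)
qed

text \<open>The Kenmotsu condition at \<open>Y = \<xi>\<close> says \<open>\<phi> (D X \<xi>) = \<phi> X\<close>, which determines \<open>D X \<xi>\<close> up to a
multiple of \<open>\<xi>\<close>; this multiple is fixed by the constant length of \<open>\<xi>\<close>.\<close>

lemma D_\<xi>: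
  assumes "X \<in> V"
  shows "D X \<xi> = X - \<eta> X \<odot> \<xi>"
proof -
  have "\<phi> (D X \<xi>) = \<phi> X"
    using D_\<phi>[OF assms \<xi>_vf] assms
    by (simp add: \<phi>_\<xi> D_zero \<eta>_\<xi> g_zero fun_scale_def const_scale_def fun_eq_iff)
  then have 1: "- D X \<xi> + \<eta> (D X \<xi>) \<odot> \<xi> = - X + \<eta> X \<odot> \<xi>"
    using \<phi>_\<phi>[of "D X \<xi>"] \<phi>_\<phi>[of X] assms by simp
  have "g \<xi> \<xi> = (\<lambda>_. \<epsilon>)"
    by (simp add: g_\<xi> \<eta>_\<xi> times_fun_def)
  then have "g (D X \<xi>) \<xi> + g \<xi> (D X \<xi>) = 0"
    using assms D_metric[of X \<xi> \<xi>] vf_const[of X \<epsilon>] by simp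
  then have "\<eta> (D X \<xi>) = 0"
    using assms \<epsilon>_cases by (auto simp: g_\<xi> fun_eq_iff)
  with 1 show ?thesis
    by (simp add: fun_scale_def fun_eq_iff) (smt (verit))
qed

text \<open>The derivative of the one-form \<open>\<eta> = \<epsilon> g(_, \<xi>)\<close>, read off from \<open>D_\<xi>\<close>. Apart from
\<open>\<eta> (D X Y)\<close> it is symmetric in \<open>X\<close> and \<open>Y\<close>, so \<open>\<eta>\<close> is closed.\<close>

lemma vf_\<eta>:
  assumes "X \<in> V" "Y \<in> V"
  shows "X (\<eta> Y) = \<eta> (D X Y) + (\<lambda>_. \<epsilon>) * g X Y - \<eta> X * \<eta> Y"
proof -
  have "X (g Y \<xi>) = g (D X Y) \<xi> + g Y (D X \<xi>)"
    using assms by (rule D_metric[OF _ _ \<xi>_vf])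
  then show ?thesis
    using assms \<epsilon>_cases
    by (auto simp: g_\<xi> D_\<xi> g_linear vf_const_mult g_sym[of Y X] fun_eq_iff algebra_simps)
qed

lemma R_\<xi>:
  assumes "X \<in> V" "Y \<in> V"
  shows "R X Y \<xi> = \<eta> X \<odot> Y - \<eta> Y \<odot> X"
  using assms g_sym[of Y X]
  by (simp add: R_eq D_\<xi> D_linear vf_\<eta> \<eta>_linear)
    (simp add: fun_scale_def fun_eq_iff algebra_simps)

text \<open>The Ricci identity for \<open>\<phi>\<close>: apply the Kenmotsu formula \<open>D_\<phi>\<close> twice and antisymmetrise. The
second derivatives of \<open>Z\<close> recombine to \<open>\<phi> (R X Y Z)\<close> and all first derivatives of \<open>Z\<close> cancel.\<close>

lemma R_\<phi>:
  assumes "X \<in> V" "Y \<in> V" "Z \<in> V"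
  shows "R X Y (\<phi> Z) = \<phi> (R X Y Z)
    + \<epsilon> \<cdot> (g Y Z \<odot> \<phi> X - g X Z \<odot> \<phi> Y - g Y (\<phi> Z) \<odot> X + g X (\<phi> Z) \<odot> Y)"
  using assms g_sym[of Y X] g_\<phi>_right[of X Y]
  by (simp add: R_eq D_\<phi> D_linear \<phi>_linear \<eta>_linear g_linear D_metric vf_\<eta> D_\<xi> g_\<xi>)
    (simp add: fun_scale_def const_scale_def fun_eq_iff algebra_simps)

section \<open>Comparison with the curvature of a space form\<close>

text \<open>Four times the candidate for the curvature tensor with all \<open>\<phi>\<close>-sectional curvatures equal to \<open>c\<close>.\<close>

definition space_form :: "real \<Rightarrow> 'a vfield \<Rightarrow> 'a vfield \<Rightarrow> 'a vfield \<Rightarrow> 'a vfield" where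
  "space_form c X Y Z =
    (c - 3 * \<epsilon>) \<cdot> (g Y Z \<odot> X - g X Z \<odot> Y)
    + (c + \<epsilon>) \<cdot>
      (\<epsilon> \<cdot> (\<eta> X * \<eta> Z) \<odot> Y - \<epsilon> \<cdot> (\<eta> Y * \<eta> Z) \<odot> X
       + (\<eta> Y * g X Z) \<odot> \<xi> - (\<eta> X * g Y Z) \<odot> \<xi>
       + g X (\<phi> Z) \<odot> \<phi> Y - g Y (\<phi> Z) \<odot> \<phi> X
       + 2 \<cdot> g X (\<phi> Y) \<odot> \<phi> Z)"

lemma space_form_vf [simp]: "X \<in> V \<Longrightarrow> Y \<in> V \<Longrightarrow> Z \<in> V \<Longrightarrow> space_form c X Y Z \<in> V"
  by (simp add: space_form_def)

text \<open>Moving every \<open>\<phi>\<close> to the right argument of \<open>g\<close> leaves only \<open>g\<close>, \<open>\<eta>\<close> and the alternating form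
\<open>g(X, \<phi>Y)\<close>, in which the symmetries of the tensor are visible.\<close>

lemma g_space_form:
  assumes "X \<in> V" "Y \<in> V" "Z \<in> V" "W \<in> V"
  shows "g (space_form c X Y Z) W p =
    (c - 3 * \<epsilon>) * (g Y Z p * g X W p - g X Z p * g Y W p)
    + (c + \<epsilon>) *
      (\<epsilon> * \<eta> X p * \<eta> Z p * g Y W p - \<epsilon> * \<eta> Y p * \<eta> Z p * g X W p
       + \<epsilon> * \<eta> Y p * \<eta> W p * g X Z p - \<epsilon> * \<eta> X p * \<eta> W p * g Y Z p
       - g X (\<phi> Z) p * g Y (\<phi> W) p + g Y (\<phi> Z) p * g X (\<phi> W) p
       - 2 * g X (\<phi> Y) p * g Z (\<phi> W) p)"
  using assms by (simp add: space_form_def g_linear g_\<xi> g_\<phi>_left algebra_simps)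

definition defect :: "real \<Rightarrow> 'a \<Rightarrow> 'a vfield \<Rightarrow> 'a vfield \<Rightarrow> 'a vfield \<Rightarrow> 'a vfield \<Rightarrow> real" where
  "defect c p X Y Z W = 4 * g (R X Y Z) W p - g (space_form c X Y Z) W p"

text \<open>The curvature symmetries of \<open>space_form c\<close> use only that \<open>g\<close> is symmetric and
\<open>(X, Y) \<mapsto> g(X, \<phi>Y)\<close> is alternating.\<close>

lemma defect_curvature: "algebraic_curvature V (defect c p)"
proof -
  interpret R: algebraic_curvature V "\<lambda>X Y Z W. g (R X Y Z) W p"
    by (rule g_R_curvature)
  have \<phi>_swap: "g Y (\<phi> X) p = - g X (\<phi> Y) p" if "X \<in> V" "Y \<in> V" for X Y
    using that by (simp add: g_\<phi>_right[of X Y])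
  have g_swap: "g Y X p = g X Y p" if "X \<in> V" "Y \<in> V" for X Y
    using that by (simp add: g_sym[of X Y])
  show ?thesis
  proof
    show "defect c p Y X Z W = - defect c p X Y Z W"
      if "X \<in> V" "Y \<in> V" "Z \<in> V" "W \<in> V" for X Y Z W
      using that R.skew12[of X Y Z W] \<phi>_swap[of X Y]
      by (simp add: defect_def g_space_form algebra_simps)
    show "defect c p X Y W Z = - defect c p X Y Z W"
      if "X \<in> V" "Y \<in> V" "Z \<in> V" "W \<in> V" for X Y Z W
      using that R.skew34[of X Y Z W] \<phi>_swap[of Z W]
      by (simp add: defect_def g_space_form algebra_simps)
    show "defect c p X Y Z W + defect c p Y Z X W + defect c p Z X Y W = 0"
      if "X \<in> V" "Y \<in> V" "Z \<in> V" "W \<in> V" for X Y Z W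
    proof -
      have "g (space_form c X Y Z) W p + g (space_form c Y Z X) W p + g (space_form c Z X Y) W p = 0"
        using that \<phi>_swap[of X Y] \<phi>_swap[of Y Z] \<phi>_swap[of X Z]
          g_swap[of X Y] g_swap[of Y Z] g_swap[of X Z]
        by (simp add: g_space_form algebra_simps)
      then show ?thesis
        using R.bianchi[OF that] unfolding defect_def by linarith
    qed
  qed (simp_all add: defect_def g_linear algebra_simps)
qed

text \<open>In the last argument, linearity over the smooth functions comes from \<open>g\<close>, so no derivative of \<open>h\<close>
appears; the pair symmetry transports it to the other arguments.\<close>

lemma defect_scale4:
  "h \<in> S \<Longrightarrow> X \<in> V \<Longrightarrow> Y \<in> V \<Longrightarrow> Z \<in> V \<Longrightarrow> W \<in> V \<Longrightarrow>
    defect c p X Y Z (h \<odot> W) = h p * defect c p X Y Z W"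
  by (simp add: defect_def g_linear algebra_simps)

text \<open>For any \<open>c\<close>, the terms with \<open>c\<close> cancel in \<open>g(space_form c X Y Z, \<xi>)\<close> and leave four times the
value that \<open>R_\<xi>\<close> prescribes.\<close>

lemma defect_\<xi>:
  assumes "X \<in> V" "Y \<in> V" "Z \<in> V"
  shows "defect c p X Y Z \<xi> = 0"
proof -
  have "g (R X Y Z) \<xi> = - g (R X Y \<xi>) Z"
    using assms R_metric_skew[of X Y \<xi> Z] by simp
  then have "g (R X Y Z) \<xi> p = \<eta> Y p * g X Z p - \<eta> X p * g Y Z p"
    using assms by (simp add: R_\<xi> g_linear)
  moreover have "g (space_form c X Y Z) \<xi> p = 4 * (\<eta> Y p * g X Z p - \<eta> X p * g Y Z p)"
    unfolding g_space_form[OF assms \<xi>_vf] using assms \<epsilon>_cases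
    by (auto simp: g_\<xi> \<eta>_\<xi> \<phi>_\<xi> g_zero algebra_simps)
  ultimately show ?thesis by (simp add: defect_def)
qed

text \<open>The right-hand side of \<open>R_\<phi>\<close>, multiplied by 4, is exactly the failure of \<open>space_form c\<close> to commute
with \<open>\<phi>\<close>; again the value of \<open>c\<close> drops out.\<close>

lemma defect_kaehler_type: "kaehler_type_curvature V (defect c p) \<phi>"
proof -
  interpret T: algebraic_curvature V "defect c p"
    by (rule defect_curvature)
  show ?thesis
  proof
    show "defect c p X Y (\<phi> Z) W = - defect c p X Y Z (\<phi> W)"
      if "X \<in> V" "Y \<in> V" "Z \<in> V" "W \<in> V" for X Y Z W
      using that \<epsilon>_square
      by (simp add: defect_def g_space_form R_\<phi> \<phi>_\<phi> \<eta>_\<phi> g_linear g_\<xi> g_\<phi>_left algebra_simps)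
    show "defect c p X Y Z (\<phi> (\<phi> W)) = - defect c p X Y Z W"
      if "X \<in> V" "Y \<in> V" "Z \<in> V" "W \<in> V" for X Y Z W
      using that T.add4[of X Y Z "- W" "\<eta> W \<odot> \<xi>"]
      by (simp add: \<phi>_\<phi> T.minus4 defect_scale4 defect_\<xi>)
  qed (simp_all add: \<phi>_add)
qed

lemma defect_eq_g:
  assumes "X \<in> V" "Y \<in> V" "Z \<in> V" "W \<in> V"
  shows "defect c p X Y Z W = g (4 \<cdot> R X Y Z - space_form c X Y Z) W p"
  using assms by (simp add: defect_def g_linear)

text \<open>This is the nondegeneracy of \<open>g\<close>, applied at each point.\<close>

lemma defect_zero_iff:
  "(\<forall>p. \<forall>X\<in>V. \<forall>Y\<in>V. \<forall>Z\<in>V. \<forall>W\<in>V. defect c p X Y Z W = 0) \<longleftrightarrow>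
    (\<forall>X\<in>V. \<forall>Y\<in>V. \<forall>Z\<in>V. 4 \<cdot> R X Y Z = space_form c X Y Z)"
proof (intro iffI ballI allI)
  fix X Y Z assume zero: "\<forall>p. \<forall>X\<in>V. \<forall>Y\<in>V. \<forall>Z\<in>V. \<forall>W\<in>V. defect c p X Y Z W = 0"
    and V: "X \<in> V" "Y \<in> V" "Z \<in> V"
  have "(4 \<cdot> R X Y Z - space_form c X Y Z) f p = 0" for f p
  proof (rule g_nondegenerate[where X = "4 \<cdot> R X Y Z - space_form c X Y Z"])
    show "4 \<cdot> R X Y Z - space_form c X Y Z \<in> V"
      using V by simp
    show "g (4 \<cdot> R X Y Z - space_form c X Y Z) W p = 0" if "W \<in> V" for W
      using zero V that defect_eq_g[OF V that, of c p] by metis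
  qed
  then show "4 \<cdot> R X Y Z = space_form c X Y Z"
    by (simp add: fun_eq_iff)
next
  fix p X Y Z W assume eq: "\<forall>X\<in>V. \<forall>Y\<in>V. \<forall>Z\<in>V. 4 \<cdot> R X Y Z = space_form c X Y Z"
    and V: "X \<in> V" "Y \<in> V" "Z \<in> V" "W \<in> V"
  have "4 \<cdot> R X Y Z = space_form c X Y Z"
    using eq V by blast
  then show "defect c p X Y Z W = 0"
    unfolding defect_eq_g[OF V] by (simp add: g_zero V)
qed

lemma defect_\<phi>_sectional:
  assumes X: "X \<in> V" and "\<eta> X p = 0"
  shows "defect c p X (\<phi> X) X (\<phi> X) = 4 * (c * (g X X p)\<^sup>2 - g (R (\<phi> X) X X) (\<phi> X) p)"
proof -
  have "g X (\<phi> X) p = 0"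
    using g_\<phi>_right[OF X X] by (simp add: fun_eq_iff)
  moreover have "g (R X (\<phi> X) X) (\<phi> X) p = - g (R (\<phi> X) X X) (\<phi> X) p"
    using X by (simp add: R_skew[of "\<phi> X" X X] g_linear)
  ultimately show ?thesis
    using assms by (simp add: defect_def g_space_form \<phi>_\<phi> \<eta>_\<phi> g_\<phi>_\<phi> g_linear g_\<xi> power2_eq_square algebra_simps)
qed

lemma constant_\<phi>_sectional_iff:
  "constant_phi_sectional_curvature \<A> \<phi> \<eta> g D c \<longleftrightarrow>
    (\<forall>p. \<forall>X\<in>V. \<eta> X p = 0 \<and> g X X p \<noteq> 0 \<longrightarrow> defect c p X (\<phi> X) X (\<phi> X) = 0)"
proof -
  have "phi_sectional_curvature \<phi> g D p X = c \<longleftrightarrow> defect c p X (\<phi> X) X (\<phi> X) = 0"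
    if "X \<in> V" "\<eta> X p = 0" "g X X p \<noteq> 0" for p X
    unfolding defect_\<phi>_sectional[OF that(1,2)] phi_sectional_curvature_def
    using that(3) by (simp add: divide_eq_eq) argo
  then show ?thesis
    unfolding constant_phi_sectional_curvature_def by blast
qed

text \<open>If \<open>X\<close> is null at \<open>p\<close>, either \<open>X\<close> is orthogonal to everything at \<open>p\<close>, and the symmetries allow the
curvature term to be written as a scalar product with \<open>X\<close>; or some \<open>Y\<close> in the kernel of
\<open>\<eta>\<close> has \<open>g(X, Y) \<noteq> 0\<close>, and then \<open>X + tY\<close> is non-null for all small \<open>t \<noteq> 0\<close>. The
polynomial \<open>Q t\<close> in \<open>t\<close> obtained from \<open>X + tY\<close> vanishes there, hence also at \<open>t = 0\<close>.\<close>

lemma defect_\<phi>_sectional_null: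
  assumes nonnull: "\<And>X. X \<in> V \<Longrightarrow> \<eta> X p = 0 \<Longrightarrow> g X X p \<noteq> 0 \<Longrightarrow> defect c p X (\<phi> X) X (\<phi> X) = 0"
    and X: "X \<in> V" and \<eta>X: "\<eta> X p = 0" and null: "g X X p = 0"
  shows "defect c p X (\<phi> X) X (\<phi> X) = 0"
proof (cases "\<forall>Y\<in>V. g X Y p = 0")
  case True
  have "g (R (\<phi> X) X X) (\<phi> X) p = - g X (R (\<phi> X) X (\<phi> X)) p"
    using X R_metric_skew[of "\<phi> X" X "\<phi> X" X] g_sym[of "R (\<phi> X) X (\<phi> X)" X] by simp
  then show ?thesis
    using True X by (simp add: defect_\<phi>_sectional[OF X \<eta>X] null)
next
  case False
  then obtain Y' where Y': "Y' \<in> V" "g X Y' p \<noteq> 0" by blast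
  \<comment> \<open>Subtracting the constant multiple \<open>\<eta>(Y')(p)\<close> of \<open>\<xi>\<close> moves the value at \<open>p\<close> into the kernel of
    \<open>\<eta>\<close>; it does not change \<open>g(X, Y')\<close> at \<open>p\<close>, since \<open>X\<close> is orthogonal to \<open>\<xi>\<close> there.\<close>
  define Y where "Y = Y' - \<eta> Y' p \<cdot> \<xi>"
  have Y: "Y \<in> V" "\<eta> Y p = 0" "g X Y p \<noteq> 0"
    using Y' X \<eta>X by (simp_all add: Y_def \<eta>_linear \<eta>_\<xi> g_linear g_\<xi>)
  interpret T: algebraic_curvature V "defect c p"
    by (rule defect_curvature)
  have scale4: "defect c p A B C (t \<cdot> E) = t * defect c p A B C E"
    if "A \<in> V" "B \<in> V" "C \<in> V" "E \<in> V" for A B C E t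
    using that by (simp add: const_scale_def defect_scale4)
  have scale3: "defect c p A B (t \<cdot> C) E = t * defect c p A B C E"
    if "A \<in> V" "B \<in> V" "C \<in> V" "E \<in> V" for A B C E t
    using that scale4[of A B E C t] T.skew34[of A B C E] T.skew34[of A B "t \<cdot> C" E] by simp
  have scale2: "defect c p A (t \<cdot> B) C E = t * defect c p A B C E"
    if "A \<in> V" "B \<in> V" "C \<in> V" "E \<in> V" for A B C E t
    using that scale4[of C E A B t] T.pair_symmetric[of C E A B] T.pair_symmetric[of C E A "t \<cdot> B"]
    by simp
  have scale1: "defect c p (t \<cdot> A) B C E = t * defect c p A B C E"
    if "A \<in> V" "B \<in> V" "C \<in> V" "E \<in> V" for A B C E t
    using that scale3[of C E A B t] T.pair_symmetric[of C E A B] T.pair_symmetric[of C E "t \<cdot> A" B]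
    by simp
  define Q where "Q t = defect c p (X + t \<cdot> Y) (\<phi> (X + t \<cdot> Y)) (X + t \<cdot> Y) (\<phi> (X + t \<cdot> Y))" for t
  have "isCont (\<lambda>t. defect c p (X + t \<cdot> Y) (\<phi> X + t \<cdot> \<phi> Y) (X + t \<cdot> Y) (\<phi> X + t \<cdot> \<phi> Y)) 0"
    using X Y
    by (simp add: T.additive scale1 scale2 scale3 scale4)
  then have "isCont Q 0"
    using X Y by (simp add: Q_def[abs_def] \<phi>_linear)
  moreover have "\<forall>\<^sub>F t in at 0. Q t = 0"
  proof -
    have norm: "g (X + t \<cdot> Y) (X + t \<cdot> Y) p = t * (2 * g X Y p + t * g Y Y p)" for t
      using X Y null g_sym[of Y X] by (simp add: g_linear algebra_simps)
    have "((\<lambda>t. 2 * g X Y p + t * g Y Y p) \<longlongrightarrow> 2 * g X Y p + 0 * g Y Y p) (at 0)"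
      by (intro tendsto_intros)
    from tendsto_imp_eventually_ne[OF this, of 0] have "\<forall>\<^sub>F t in at 0. 2 * g X Y p + t * g Y Y p \<noteq> 0"
      using Y by simp
    moreover have "\<forall>\<^sub>F t in at 0. t \<noteq> (0::real)"
      by (simp add: eventually_at_filter)
    ultimately show ?thesis
    proof eventually_elim
      case (elim t)
      then show ?case
        using X Y \<eta>X norm[of t] by (simp add: Q_def nonnull \<eta>_linear)
    qed
  qed
  ultimately have "Q 0 = 0"
    using tendsto_unique[of "at 0" Q] tendsto_eventually[of Q 0 "at 0"] by (simp add: isCont_def)
  moreover have "X + 0 \<cdot> Y = X"
    by (simp add: const_scale_def fun_scale_def fun_eq_iff)
  ultimately show ?thesis by (simp add: Q_def)
qed

text \<open>Every \<open>X\<close> differs from a field in the kernel of \<open>\<eta>\<close> at \<open>p\<close> by a constant multiple of \<open>\<xi>\<close>, to which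
neither \<open>\<phi>\<close> nor \<open>defect\<close> responds. So the hypothesis reaches all \<open>X\<close> and the Kaehler argument applies.\<close>

lemma constant_\<phi>_sectional_imp_defect_zero:
  assumes const: "constant_phi_sectional_curvature \<A> \<phi> \<eta> g D c"
    and V: "X \<in> V" "Y \<in> V" "Z \<in> V" "W \<in> V"
  shows "defect c p X Y Z W = 0"
proof -
  interpret T: kaehler_type_curvature V "defect c p" \<phi>
    by (rule defect_kaehler_type)
  have ker: "defect c p X (\<phi> X) X (\<phi> X) = 0" if "X \<in> V" "\<eta> X p = 0" for X
    using that const defect_\<phi>_sectional_null[of p c X]
    unfolding constant_\<phi>_sectional_iff by blast
  have "defect c p X (\<phi> X) X (\<phi> X) = 0" if X: "X \<in> V" for X
  proof -
    define X' where "X' = X - \<eta> X p \<cdot> \<xi>"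
    have X': "X' \<in> V" "\<eta> X' p = 0"
      using X by (simp_all add: X'_def \<eta>_linear \<eta>_\<xi>)
    have eq: "X = X' + (\<lambda>_. \<eta> X p) \<odot> \<xi>"
      by (simp add: X'_def const_scale_def)
    have \<xi>4: "defect c p A B C ((\<lambda>_. \<eta> X p) \<odot> \<xi>) = 0" if "A \<in> V" "B \<in> V" "C \<in> V" for A B C
      using that by (simp add: defect_scale4 defect_\<xi>)
    have \<xi>3: "defect c p A B ((\<lambda>_. \<eta> X p) \<odot> \<xi>) C = 0" if "A \<in> V" "B \<in> V" "C \<in> V" for A B C
      using that \<xi>4[of A B C] T.skew34[of A B C "(\<lambda>_. \<eta> X p) \<odot> \<xi>"] by simp
    have \<xi>1: "defect c p ((\<lambda>_. \<eta> X p) \<odot> \<xi>) A B C = 0" if "A \<in> V" "B \<in> V" "C \<in> V" for A B C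
      using that \<xi>3[of B C A] T.pair_symmetric[of B C "(\<lambda>_. \<eta> X p) \<odot> \<xi>" A] by simp
    have "\<phi> X = \<phi> X'"
      using X by (simp add: X'_def \<phi>_linear \<phi>_\<xi>) (simp add: const_scale_def fun_scale_def fun_eq_iff)
    then have "defect c p X (\<phi> X) X (\<phi> X) = defect c p (X' + (\<lambda>_. \<eta> X p) \<odot> \<xi>) (\<phi> X') (X' + (\<lambda>_. \<eta> X p) \<odot> \<xi>) (\<phi> X')"
      using eq by simp
    also have "\<dots> = defect c p X' (\<phi> X') X' (\<phi> X')"
      using X' by (simp add: T.additive \<xi>1 \<xi>3)
    also have "\<dots> = 0"
      using ker X' by simp
    finally show ?thesis .
  qed
  then show ?thesis
    using V by (rule T.zero_if_J_sectional_zero)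
qed

lemma constant_\<phi>_sectional_iff_space_form:
  "constant_phi_sectional_curvature \<A> \<phi> \<eta> g D c \<longleftrightarrow>
    (\<forall>X\<in>V. \<forall>Y\<in>V. \<forall>Z\<in>V. 4 \<cdot> R X Y Z = space_form c X Y Z)"
  unfolding defect_zero_iff[symmetric]
  using constant_\<phi>_sectional_imp_defect_zero constant_\<phi>_sectional_iff \<phi>_vf by blast

end

theorem theorem1:
  fixes \<A> :: "('a::{t2_space,second_countable_topology}, 'b::euclidean_space) chart set"
    and \<phi> :: "'a vfield \<Rightarrow> 'a vfield" and \<xi> :: "'a vfield"
    and \<eta> :: "'a vfield \<Rightarrow> 'a \<Rightarrow> real"
    and g :: "'a vfield \<Rightarrow> 'a vfield \<Rightarrow> 'a \<Rightarrow> real"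
    and D :: "'a vfield \<Rightarrow> 'a vfield \<Rightarrow> 'a vfield"
    and \<epsilon> c :: real and n :: nat
  assumes "n \<ge> 1" and "DIM('b) = 2 * n + 1"
    and "smooth_atlas \<A>"
    and "kenmotsu_pseudo_metric \<A> \<phi> \<xi> \<eta> g \<epsilon> D"
  shows "constant_phi_sectional_curvature \<A> \<phi> \<eta> g D c \<longleftrightarrow>
    (\<forall>X\<in>vector_fields \<A>. \<forall>Y\<in>vector_fields \<A>. \<forall>Z\<in>vector_fields \<A>.
      4 \<cdot> curvature D X Y Z =
        (c - 3 * \<epsilon>) \<cdot> (g Y Z \<odot> X - g X Z \<odot> Y)
        + (c + \<epsilon>) \<cdot>
          (\<epsilon> \<cdot> (\<eta> X * \<eta> Z) \<odot> Y - \<epsilon> \<cdot> (\<eta> Y * \<eta> Z) \<odot> X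
           + (\<eta> Y * g X Z) \<odot> \<xi> - (\<eta> X * g Y Z) \<odot> \<xi>
           + g X (\<phi> Z) \<odot> \<phi> Y - g Y (\<phi> Z) \<odot> \<phi> X
           + 2 \<cdot> g X (\<phi> Y) \<odot> \<phi> Z))"
proof -
  interpret kenmotsu_manifold \<A> \<phi> \<xi> \<eta> g D \<epsilon>
    using assms(3,4) by unfold_locales
  show ?thesis
    by (rule constant_\<phi>_sectional_iff_space_form[unfolded space_form_def])
qed

end
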